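(* For any $r,R>1$ there are no proper holomorphic mappings $\mathbb{A}_r\times\mathbb{C}\to\mathbb{A}_R\times\mathbb{C}_*$.
   Context: For $\rho>1$, $\mathbb{A}_\rho:=\{z\in\mathbb{C}:\ 1/\rho<|z|<\rho\}$, and $\mathbb{C}_*=\mathbb{C}\setminus\{0\}$. *)

theory Defs
  imports "HOL-Complex_Analysis.Complex_Analysis"
begin

definition annulus :: "real \<Rightarrow> complex set"
  where "annulus \<rho> = {z. 1 / \<rho> < cmod z \<and> cmod z < \<rho>}"

definition cscale :: "complex \<Rightarrow> complex \<times> complex \<Rightarrow> complex \<times> complex"
  where "cscale c v = (c * fst v, c * snd v)"

lemma vector_space_cscale: "vector_space cscale"
  by unfold_locales (auto simp: cscale_def algebra_simps)

text \<open>
  Holomorphy in two variables: the real Frechet derivative exists and is complex-linear at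
  every point. As for \<open>holomorphic_on\<close>, the derivative is taken within \<open>S\<close>, so this is the
  usual notion only when \<open>S\<close> is open.
\<close>

definition holomorphic2_on ::
    "(complex \<times> complex \<Rightarrow> complex \<times> complex) \<Rightarrow> (complex \<times> complex) set \<Rightarrow> bool"
    (infixl \<open>holomorphic2'_on\<close> 50)
  where "f holomorphic2_on S \<longleftrightarrow>
    (\<forall>p\<in>S. \<exists>f'. (f has_derivative f') (at p within S) \<and> Vector_Spaces.linear cscale cscale f')"

lemma open_annulus: "open (annulus \<rho>)"
proof -
  have "annulus \<rho> = {z. 1 / \<rho> < cmod z} \<inter> {z. cmod z < \<rho>}"
    by (auto simp: annulus_def)
  then show ?thesis
    by (auto intro!: open_Int open_Collect_less continuous_intros)
qed

text \<open>
  The library defines \<open>proper_map\<close> as a closed map with compact fibres. For continuous maps between subspaces of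
  metric spaces this agrees with the condition that preimages of compact sets are compact.
\<close>

lemma proper_map_iff_compact_preimages:
  fixes f :: "'a::metric_space \<Rightarrow> 'b::metric_space"
  assumes "continuous_on S f" and "f \<in> S \<rightarrow> T"
  shows "proper_map (top_of_set S) (top_of_set T) f \<longleftrightarrow>
    (\<forall>K. compact K \<and> K \<subseteq> T \<longrightarrow> compact {x \<in> S. f x \<in> K})"
proof -
  let ?X = "top_of_set S" and ?Y = "top_of_set T"
  have "k_space ?Y"
    by (metis metrizable_imp_k_space metrizable_space_euclidean metrizable_space_subtopology)
  moreover have "kc_space ?Y"
    by (simp add: Hausdorff_imp_kc_space Hausdorff_space_subtopology)
  moreover have "f \<in> topspace ?X \<rightarrow> topspace ?Y"
    using assms(2) by simp
  moreover have "continuous_map ?X ?Y f \<or> kc_space ?X"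
    using assms by (simp add: continuous_map_in_subtopology image_subset_iff_funcset)
  ultimately have 1: "proper_map ?X ?Y f"
    if "\<And>K. compactin ?Y K \<Longrightarrow> compactin ?X {x \<in> topspace ?X. f x \<in> K}"
    using that by (rule compact_imp_proper_map)
  have 2: "compactin ?X {x \<in> topspace ?X. f x \<in> K}"
    if "proper_map ?X ?Y f" "compactin ?Y K" for K
    using that by (rule compactin_proper_map_preimage)
  have 3: "compactin ?Y K \<longleftrightarrow> compact K \<and> K \<subseteq> T"
    and 4: "compactin ?X {x \<in> topspace ?X. f x \<in> K} \<longleftrightarrow> compact {x \<in> S. f x \<in> K}" for K
    by (auto simp: compactin_subtopology)
  show ?thesis
  proof (intro iffI allI impI)
    fix K
    assume "proper_map ?X ?Y f" and "compact K \<and> K \<subseteq> T"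
    then show "compact {x \<in> S. f x \<in> K}"
      using 2[of K] unfolding 3 4 by simp
  next
    assume "\<forall>K. compact K \<and> K \<subseteq> T \<longrightarrow> compact {x \<in> S. f x \<in> K}"
    then show "proper_map ?X ?Y f"
      using 1 unfolding 3 4 by simp
  qed
qed

end

theory Submission
  imports Defs
begin

text \<open>
  Already the restriction of such a map to a single complex line rules it out. On the line
  \<open>{z} \<times> \<complex>\<close> the first component is a bounded entire function, so by Liouville's theorem it is
  a constant \<open>c\<close>. The line is therefore mapped into \<open>{c} \<times> \<complex>\<^sub>*\<close>, and as the line is closed
  in the domain, properness of the whole map makes the second component on it a proper holomorphic
  map \<open>\<complex> \<rightarrow> \<complex>\<^sub>*\<close>.

  There is no such map (\<open>entire_nonzero_not_proper\<close>): the plane has one end and the punctured plane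
  has two, so a proper \<open>h\<close> would have to send a neighbourhood of infinity either into a neighbourhood
  of \<open>0\<close> or into a neighbourhood of \<open>\<infinity>\<close>. In these cases \<open>h\<close> or \<open>1/h\<close>, respectively, is bounded and
  entire, hence constant, which contradicts properness because the plane is not compact.
\<close>

text \<open>
  The vertical line is the image of \<open>\<complex>\<close> under a complex-affine map. The chain rule gives the
  derivative \<open>v \<mapsto> f' (0, v) = v * f' (0, 1)\<close>, which in each component is multiplication by a
  complex number.
\<close>

lemma holomorphic2_on_vertical_line:
  assumes f: "f holomorphic2_on S" and line: "{z} \<times> UNIV \<subseteq> S"
  shows "(\<lambda>w. fst (f (z, w))) holomorphic_on UNIV"
    and "(\<lambda>w. snd (f (z, w))) holomorphic_on UNIV"
proof -
  have "\<exists>a. ((\<lambda>w. fst (f (z, w))) has_field_derivative fst a) (at w) \<and>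
            ((\<lambda>w. snd (f (z, w))) has_field_derivative snd a) (at w)" for w
  proof -
    have "(z, w) \<in> S" using line by auto
    then obtain f' where f': "(f has_derivative f') (at (z, w) within S)"
        and lin: "Vector_Spaces.linear cscale cscale f'"
      using f unfolding holomorphic2_on_def by blast
    have "(f has_derivative f') (at (z, w) within range (Pair z))"
      using f' by (rule has_derivative_subset) (use line in auto)
    moreover have "(Pair z has_derivative (\<lambda>v. (0, v))) (at w)"
      by (auto intro!: derivative_eq_intros)
    ultimately have D: "((\<lambda>w. f (z, w)) has_derivative (\<lambda>v. f' (0, v))) (at w)"
      using has_derivative_in_compose[of "Pair z" "\<lambda>v. (0, v)" w UNIV f f'] by simp
    have "(\<lambda>v. f' (0, v)) = (\<lambda>v. cscale v (f' (0, 1)))"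
    proof
      fix v
      have "f' (cscale v (0, 1)) = cscale v (f' (0, 1))"
        using lin by (simp add: Vector_Spaces.linear_iff)
      then show "f' (0, v) = cscale v (f' (0, 1))" by (simp add: cscale_def)
    qed
    with D have "((\<lambda>w. f (z, w)) has_derivative (\<lambda>v. cscale v (f' (0, 1)))) (at w)"
      by (rule back_subst)
    from has_derivative_fst[OF this] has_derivative_snd[OF this] show ?thesis
      by (intro exI[of _ "f' (0, 1)"]) (simp add: has_field_derivative_def cscale_def mult_commute_abs)
  qed
  then show "(\<lambda>w. fst (f (z, w))) holomorphic_on UNIV" "(\<lambda>w. snd (f (z, w))) holomorphic_on UNIV"
    unfolding holomorphic_on_def field_differentiable_def by blast+
qed

text \<open>
  Outside a disc \<open>h\<close> avoids the unit circle, and the exterior of a disc is connected, so there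
  \<open>h\<close> stays on one side of the circle. Thus \<open>h\<close> or \<open>1/h\<close> is bounded and Liouville's theorem
  applies; a constant has all of \<open>\<complex>\<close> as its only nonempty fibre.
\<close>

lemma entire_nonzero_not_proper:
  fixes h :: "complex \<Rightarrow> complex"
  assumes hol: "h holomorphic_on UNIV" and nz: "\<And>w. h w \<noteq> 0"
  shows "\<exists>K. compact K \<and> K \<subseteq> - {0} \<and> \<not> compact (h -` K)"
proof (rule ccontr)
  assume "\<not> ?thesis"
  then have proper: "compact (h -` K)" if "compact K" "0 \<notin> K" for K
    using that by blast
  have cont: "continuous_on UNIV h"
    by (rule holomorphic_on_imp_continuous_on[OF hol])
  have "bounded (h -` sphere 0 1)"
    by (intro compact_imp_bounded proper) auto
  then obtain B where B: "\<forall>w\<in>h -` sphere 0 1. cmod w \<le> B"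
    unfolding bounded_iff by (elim exE)
  have outside: "cmod (h w) \<noteq> 1" if "w \<notin> cball 0 B" for w
    using bspec[OF B, of w] that by auto
  have "connected (- cball (0::complex) B)"
    by (rule connected_complement_bounded_convex) auto
  then have conn: "connected ((\<lambda>w. cmod (h w)) ` (- cball 0 B))"
    by (intro connected_continuous_image continuous_intros continuous_on_subset[OF cont]) auto
  have side: "(\<forall>w\<in>- cball 0 B. cmod (h w) \<le> 1) \<or> (\<forall>w\<in>- cball 0 B. 1 \<le> cmod (h w))"
  proof (rule ccontr)
    assume "\<not> ?thesis"
    then obtain u v where uv: "u \<in> - cball 0 B" "v \<in> - cball 0 B" "cmod (h u) < 1" "1 < cmod (h v)"
      by (auto simp: not_le)
    then have "1 \<in> (\<lambda>w. cmod (h w)) ` (- cball 0 B)"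
      using connectedD_interval[OF conn, of "cmod (h u)" "cmod (h v)" 1] by auto
    then show False using outside by auto
  qed
  have liouville: "\<exists>c. \<forall>w. g w = c"
    if g: "g holomorphic_on UNIV" and le: "\<forall>w\<in>- cball 0 B. cmod (g w) \<le> 1" for g
  proof -
    have "bounded (g ` cball 0 B)"
      by (intro compact_imp_bounded compact_continuous_image
          continuous_on_subset[OF holomorphic_on_imp_continuous_on[OF g]]) auto
    moreover have "bounded (g ` (- cball 0 B))"
      using le by (auto simp: bounded_iff)
    ultimately have "bounded (g ` (cball 0 B \<union> - cball 0 B))"
      by (simp only: image_Un bounded_Un)
    then have "bounded (range g)"
      by (simp only: Compl_partition)
    then show ?thesis
      using Liouville_theorem[OF g] by (auto simp: constant_on_def)
  qed
  have "\<exists>c. \<forall>w. h w = c"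
    using side
  proof
    assume "\<forall>w\<in>- cball 0 B. cmod (h w) \<le> 1"
    then show ?thesis by (rule liouville[OF hol])
  next
    assume "\<forall>w\<in>- cball 0 B. 1 \<le> cmod (h w)"
    then have "\<forall>w\<in>- cball 0 B. cmod (inverse (h w)) \<le> 1"
      by (simp add: norm_inverse inverse_le_1_iff)
    moreover have "(\<lambda>w. inverse (h w)) holomorphic_on UNIV"
      using hol nz by (intro holomorphic_intros) auto
    ultimately obtain c where "\<forall>w. inverse (h w) = c"
      using liouville by blast
    then show ?thesis by (metis inverse_inverse_eq)
  qed
  then obtain c where c: "\<And>w. h w = c" by blast
  have "compact (h -` {c})"
    using nz c by (intro proper) auto
  then show False
    using c not_compact_UNIV[where 'a = complex] by (simp add: vimage_def)
qed

theorem theorem7: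
  fixes r R :: real
  assumes "r > 1" and "R > 1"
  shows "\<not> (\<exists>f. f holomorphic2_on (annulus r \<times> UNIV) \<and>
    f \<in> annulus r \<times> UNIV \<rightarrow> annulus R \<times> (- {0}) \<and>
    proper_map (top_of_set (annulus r \<times> UNIV)) (top_of_set (annulus R \<times> (- {0}))) f)"
proof (intro notI, elim exE conjE)
  fix f
  assume hol: "f holomorphic2_on (annulus r \<times> UNIV)"
    and maps: "f \<in> annulus r \<times> UNIV \<rightarrow> annulus R \<times> (- {0})"
    and proper: "proper_map (top_of_set (annulus r \<times> UNIV)) (top_of_set (annulus R \<times> (- {0}))) f"
  have one: "1 \<in> annulus r"
    using assms(1) by (simp add: annulus_def)
  have mem: "fst (f (1, w)) \<in> annulus R" "snd (f (1, w)) \<noteq> 0" for w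
    using funcset_mem[OF maps, of "(1, w)"] one by auto
  have "{1} \<times> UNIV \<subseteq> annulus r \<times> (UNIV :: complex set)"
    using one by auto
  note line = holomorphic2_on_vertical_line[OF hol this]
  have "bounded (annulus R)"
    by (rule bounded_subset[of "ball 0 R"]) (auto simp: annulus_def)
  then have "bounded (range (\<lambda>w. fst (f (1, w))))"
    by (rule bounded_subset) (use mem in auto)
  then obtain c where c: "\<And>w. fst (f (1, w)) = c"
    using Liouville_theorem[OF line(1)] unfolding constant_on_def by blast
  obtain K where K: "compact K" "K \<subseteq> - {0}" "\<not> compact ((\<lambda>w. snd (f (1, w))) -` K)"
    using entire_nonzero_not_proper[OF line(2) mem(2)] by blast
  have "compactin (top_of_set (annulus R \<times> (- {0}))) ({c} \<times> K)"
    using K c mem(1) by (auto simp: compactin_subtopology intro!: compact_Times)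
  from compactin_proper_map_preimage[OF proper this]
  have "compact {p \<in> annulus r \<times> UNIV. f p \<in> {c} \<times> K}"
    by (simp add: compactin_subtopology)
  then have "compact ({p \<in> annulus r \<times> UNIV. f p \<in> {c} \<times> K} \<inter> {1} \<times> UNIV)"
    by (intro compact_Int_closed closed_Times) auto
  then have "compact (snd ` ({p \<in> annulus r \<times> UNIV. f p \<in> {c} \<times> K} \<inter> {1} \<times> UNIV))"
    by (intro compact_continuous_image continuous_intros)
  also have "snd ` ({p \<in> annulus r \<times> UNIV. f p \<in> {c} \<times> K} \<inter> {1} \<times> UNIV)
      = (\<lambda>w. snd (f (1, w))) -` K"
  proof (intro equalityI subsetI)
    fix w assume "w \<in> (\<lambda>w. snd (f (1, w))) -` K"
    then have "(1, w) \<in> {p \<in> annulus r \<times> UNIV. f p \<in> {c} \<times> K} \<inter> {1} \<times> UNIV"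
      using one c by (simp add: mem_Times_iff)
    then show "w \<in> snd ` ({p \<in> annulus r \<times> UNIV. f p \<in> {c} \<times> K} \<inter> {1} \<times> UNIV)"
      by (rule image_eqI[rotated]) simp
  next
    fix w assume "w \<in> snd ` ({p \<in> annulus r \<times> UNIV. f p \<in> {c} \<times> K} \<inter> {1} \<times> UNIV)"
    then have "f (1, w) \<in> {c} \<times> K" by auto
    then show "w \<in> (\<lambda>w. snd (f (1, w))) -` K" by (simp add: mem_Times_iff)
  qed
  finally show False using K(3) by blast
qed

end
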